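(* Every computable partial function $f:\mathbb{N}\rightharpoonup\mathbb{N}$ can be implemented by a process $p$ of the Krivine machine with I/O; that is, there is a process $p$ such that $(p,\mathrm{bin}(n),\varepsilon)\leadsto^*(\top,\varepsilon,\mathrm{bin}(f(n)))$ for all $n\in\mathrm{dom}(f)$.
   Context: Syntax. Terms: $t ::= x \mid \lambda x.\,t \mid t\,t \mid \mathsf{cc} \mid \mathsf{k}_\pi \mid \mathsf{r} \mid \mathsf{w1} \mid \mathsf{w0} \mid \mathsf{end}$, where $\pi$ is a stack and $\mathsf{cc},\mathsf{r},\mathsf{w0},\mathsf{w1},\mathsf{end}$ are constants. Stacks: $\pi ::= \varepsilon \mid t\cdot\pi$ with $t$ closed. Processes: $p ::= t\star\pi \mid \top$ with $t$ closed, $\pi$ a stack, and $\top$ a process constant. Evaluation relation $\succ$ on processes: $tu\star\pi\succ t\star u\cdot\pi$; $(\lambda x.\,t[x])\star u\cdot\pi\succ t[u]\star\pi$; $\mathsf{cc}\star t\cdot\pi\succ t\star\mathsf{k}_\pi\cdot\pi$; $\mathsf{k}_\pi\star t\cdot\rho\succ t\star\pi$. Execution contexts are triples $(p,\iota,o)$ with $p$ a process and $\iota,o\in\{0,1\}^*$ (input and output). The execution relation $\leadsto$ is given by: - $(t\star\pi,\iota,o)\leadsto(u\star\rho,\iota,o)$ whenever $t\star\pi\succ u\star\rho$; - $(\mathsf{r}\star t\cdot u\cdot v\cdot\pi,0\iota,o)\leadsto(t\star\pi,\iota,o)$; - $(\mathsf{r}\star t\cdot u\cdot v\cdot\pi,1\iota,o)\leadsto(u\star\pi,\iota,o)$;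 - $(\mathsf{r}\star t\cdot u\cdot v\cdot\pi,\varepsilon,o)\leadsto(v\star\pi,\varepsilon,o)$; - $(\mathsf{w0}\star t\cdot\pi,\iota,o)\leadsto(t\star\pi,\iota,0o)$; - $(\mathsf{w1}\star t\cdot\pi,\iota,o)\leadsto(t\star\pi,\iota,1o)$; - $(\mathsf{end}\star\pi,\iota,o)\leadsto(\top,\iota,o)$. $\leadsto^*$ is its reflexive-transitive closure. For $n\in\mathbb{N}$, $\mathrm{bin}(n)\in\{0,1\}^*$ is the base 2 representation of $n$ (most significant bit first, no leading zeros), with $\mathrm{bin}(0)=\varepsilon$; e.g. $\mathrm{bin}(1)=1$, $\mathrm{bin}(2)=10$. *)

theory Defs
  imports Main
begin

section \<open>Terms, stacks and processes\<close>

text \<open>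
  Variables are de Bruijn indices, so terms are identified up to renaming of bound variables.
  The raw datatype allows open terms in stacks; the predicates \<open>is_term\<close>, \<open>is_stack\<close> and
  \<open>is_process\<close> single out the expressions generated by the grammar.
\<close>

datatype trm =
    Var nat
  | Lam trm
  | App trm trm
  | CC
  | Cont "trm list"
  | Rd
  | W1
  | W0
  | End

type_synonym stack = "trm list"

datatype process = Proc trm stack (infix "\<star>" 55) | Top

text \<open>\<open>is_term k t\<close>: \<open>t\<close> is a term all of whose free variables have an index below \<open>k\<close>.\<close>

fun is_term :: "nat \<Rightarrow> trm \<Rightarrow> bool" where
  "is_term k (Var i) \<longleftrightarrow> i < k"
| "is_term k (Lam t) \<longleftrightarrow> is_term (Suc k) t"
| "is_term k (App t u) \<longleftrightarrow> is_term k t \<and> is_term k u"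
| "is_term k (Cont \<pi>) \<longleftrightarrow> (\<forall>t\<in>set \<pi>. is_term 0 t)"
| "is_term k CC \<longleftrightarrow> True"
| "is_term k Rd \<longleftrightarrow> True"
| "is_term k W1 \<longleftrightarrow> True"
| "is_term k W0 \<longleftrightarrow> True"
| "is_term k End \<longleftrightarrow> True"

abbreviation closed_term :: "trm \<Rightarrow> bool" where
  "closed_term t \<equiv> is_term 0 t"

definition is_stack :: "stack \<Rightarrow> bool" where
  "is_stack \<pi> \<longleftrightarrow> (\<forall>t\<in>set \<pi>. closed_term t)"

fun is_process :: "process \<Rightarrow> bool" where
  "is_process (t \<star> \<pi>) \<longleftrightarrow> closed_term t \<and> is_stack \<pi>"
| "is_process Top \<longleftrightarrow> True"

text \<open>
  \<open>subst k u t\<close> replaces the variable with index \<open>k\<close> in \<open>t\<close> by \<open>u\<close> and removes the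
  corresponding binder. The substituted term always comes from a stack, hence is closed and need
  not be lifted under binders; the stack inside \<open>Cont \<pi>\<close> has no free variables.
\<close>

primrec subst :: "nat \<Rightarrow> trm \<Rightarrow> trm \<Rightarrow> trm" where
  "subst k u (Var i) = (if i = k then u else if k < i then Var (i - 1) else Var i)"
| "subst k u (Lam t) = Lam (subst (Suc k) u t)"
| "subst k u (App s t) = App (subst k u s) (subst k u t)"
| "subst k u (Cont \<pi>) = Cont \<pi>"
| "subst k u CC = CC"
| "subst k u Rd = Rd"
| "subst k u W1 = W1"
| "subst k u W0 = W0"
| "subst k u End = End"


section \<open>Evaluation and execution\<close>

inductive eval_step :: "process \<Rightarrow> process \<Rightarrow> bool" (infix "\<succ>" 50) where
  push: "App t u \<star> \<pi> \<succ> t \<star> u # \<pi>"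
| grab: "Lam t \<star> u # \<pi> \<succ> subst 0 u t \<star> \<pi>"
| save: "CC \<star> t # \<pi> \<succ> t \<star> Cont \<pi> # \<pi>"
| restore: "Cont \<pi> \<star> t # \<rho> \<succ> t \<star> \<pi>"

text \<open>Bits are Booleans: \<open>False\<close> is 0 and \<open>True\<close> is 1.\<close>

type_synonym exec_context = "process \<times> bool list \<times> bool list"

inductive exec_step :: "exec_context \<Rightarrow> exec_context \<Rightarrow> bool" (infix "\<leadsto>" 50) where
  eval: "t \<star> \<pi> \<succ> u \<star> \<rho> \<Longrightarrow> (t \<star> \<pi>, \<iota>, out) \<leadsto> (u \<star> \<rho>, \<iota>, out)"
| read0: "(Rd \<star> t # u # v # \<pi>, False # \<iota>, out) \<leadsto> (t \<star> \<pi>, \<iota>, out)"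
| read1: "(Rd \<star> t # u # v # \<pi>, True # \<iota>, out) \<leadsto> (u \<star> \<pi>, \<iota>, out)"
| read_empty: "(Rd \<star> t # u # v # \<pi>, [], out) \<leadsto> (v \<star> \<pi>, [], out)"
| write0: "(W0 \<star> t # \<pi>, \<iota>, out) \<leadsto> (t \<star> \<pi>, \<iota>, False # out)"
| write1: "(W1 \<star> t # \<pi>, \<iota>, out) \<leadsto> (t \<star> \<pi>, \<iota>, True # out)"
| stop: "(End \<star> \<pi>, \<iota>, out) \<leadsto> (Top, \<iota>, out)"

abbreviation exec_steps :: "exec_context \<Rightarrow> exec_context \<Rightarrow> bool" (infix "\<leadsto>\<^sup>*" 50) where
  "c \<leadsto>\<^sup>* d \<equiv> exec_step\<^sup>*\<^sup>* c d"

lemma is_term_mono: "is_term k t \<Longrightarrow> k \<le> l \<Longrightarrow> is_term l t"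
  by (induction k t arbitrary: l rule: is_term.induct) auto

lemma is_term_subst: "is_term (Suc k) t \<Longrightarrow> closed_term u \<Longrightarrow> is_term k (subst k u t)"
proof (induction t arbitrary: k)
  case (Var i)
  then show ?case using is_term_mono[of 0 u k] by auto
qed auto

lemma is_process_eval_step: "p \<succ> q \<Longrightarrow> is_process p \<Longrightarrow> is_process q"
  by (induction rule: eval_step.induct) (auto simp: is_stack_def is_term_subst)

lemma is_process_exec_step: "(p, \<iota>, out) \<leadsto> (q, \<iota>', out') \<Longrightarrow> is_process p \<Longrightarrow> is_process q"
  by (erule exec_step.cases) (auto simp: is_stack_def dest: is_process_eval_step)


section \<open>Binary representation\<close>

text \<open>Most significant bit first, without leading zeros.\<close>

fun bin :: "nat \<Rightarrow> bool list" where
  "bin n = (if n = 0 then [] else bin (n div 2) @ [odd n])"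

declare bin.simps [simp del]


section \<open>Computable partial functions\<close>

text \<open>
  Computability is partial recursiveness in the sense of Kleene. A \<open>k\<close>-ary partial function is
  represented on argument lists of length \<open>k\<close>; its values on other lists are irrelevant.
\<close>

definition compose :: "(nat list \<rightharpoonup> nat) \<Rightarrow> (nat list \<rightharpoonup> nat) list \<Rightarrow> nat list \<rightharpoonup> nat" where
  "compose f gs xs = Option.bind (those (map (\<lambda>g. g xs) gs)) f"

fun prim_recursion :: "(nat list \<rightharpoonup> nat) \<Rightarrow> (nat list \<rightharpoonup> nat) \<Rightarrow> nat list \<rightharpoonup> nat" where
  "prim_recursion f g [] = None"
| "prim_recursion f g (0 # xs) = f xs"
| "prim_recursion f g (Suc n # xs) =
     Option.bind (prim_recursion f g (n # xs)) (\<lambda>v. g (n # v # xs))"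

text \<open>The search diverges if it meets an undefined value of \<open>f\<close> before a zero.\<close>

definition minimization :: "(nat list \<rightharpoonup> nat) \<Rightarrow> nat list \<rightharpoonup> nat" where
  "minimization f xs =
     (if \<exists>n. f (n # xs) = Some 0 \<and> (\<forall>m<n. f (m # xs) \<noteq> None)
      then Some (LEAST n. f (n # xs) = Some 0) else None)"

inductive partial_recursive :: "nat \<Rightarrow> (nat list \<rightharpoonup> nat) \<Rightarrow> bool" where
  zero: "partial_recursive k (\<lambda>xs. Some 0)"
| succ: "partial_recursive 1 (\<lambda>xs. Some (Suc (hd xs)))"
| proj: "i < k \<Longrightarrow> partial_recursive k (\<lambda>xs. Some (xs ! i))"
| comp: "partial_recursive (length gs) f \<Longrightarrow> (\<forall>g\<in>set gs. partial_recursive k g) \<Longrightarrow>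
    partial_recursive k (compose f gs)"
| prim_rec: "partial_recursive k f \<Longrightarrow> partial_recursive (k + 2) g \<Longrightarrow>
    partial_recursive (k + 1) (prim_recursion f g)"
| minim: "partial_recursive (k + 1) f \<Longrightarrow> partial_recursive k (minimization f)"

definition computable :: "(nat \<rightharpoonup> nat) \<Rightarrow> bool" where
  "computable f \<longleftrightarrow> (\<exists>g. partial_recursive 1 g \<and> (\<forall>n. f n = g [n]))"

end

theory Submission
  imports Defs
begin

text \<open>
  The machine evaluates by weak head reduction, so a term that must finish a computation before it
  goes on has to be written in continuation-passing style. A partial function \<open>g\<close> on lists of
  numbers is implemented by a closed term \<open>F\<close> that, run against the code of a list \<open>xs\<close> and a
  continuation \<open>c\<close>, arrives at \<open>c\<close> run against the numeral of \<open>g xs\<close>, with input, output and the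
  rest of the stack as before. Three choices keep this simple.

  First, numbers are Scott numerals, \<open>0 = \<lambda>z s. z\<close> and \<open>n + 1 = \<lambda>z s. s n\<close>. Substituting a numeral
  for \<open>x\<close> in \<open>\<lambda>z s. s x\<close> yields syntactically the next numeral. Hence every number that is passed
  to a continuation is a literal numeral and never a suspended computation, and no equivalence of
  terms is needed. Secondly, an argument list is passed as one nested pair \<open>\<lambda>k. k x xs\<close>, so that
  functions of all arities have the same calling convention. Thirdly, primitive recursion,
  minimization and all conversions are loops made with Turing's fixed point combinator. The
  closure of the implementable functions under the schemes of partial recursiveness is
  \<open>implements_partial_recursive\<close>.

  Input and output need two more loops. The reader consumes the digits from the most significant
  one, replacing its accumulator \<open>a\<close> by \<open>2 a\<close> or \<open>2 a + 1\<close> (\<open>reads_number\<close>). The printer emits the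
  digits from the least significant one, by repeated halving; this is the right order because every
  write puts its bit in front of the earlier output (\<open>prints_number\<close>).
\<close>

section \<open>Running closed terms\<close>

lemma subst_is_term: "is_term k t \<Longrightarrow> subst k u t = t"
  by (induction k t rule: is_term.induct) auto

lemma subst_closed [simp]: "closed_term t \<Longrightarrow> subst k u t = t"
  by (rule subst_is_term[OF is_term_mono[of 0 t k]]) auto

lemma closed_imp_is_term_Suc [simp]: "closed_term t \<Longrightarrow> is_term (Suc k) t"
  by (rule is_term_mono[of 0]) auto

text \<open>
  The execution rules are read backwards: to show that a context reaches \<open>d\<close>, it suffices that its
  successor does. In this form, resolution with the rules below is symbolic execution, and each
  lemma about a program becomes one further rule.
\<close>

lemma run_App: "(t \<star> u # \<pi>, \<iota>, out) \<leadsto>\<^sup>* d \<Longrightarrow> (App t u \<star> \<pi>, \<iota>, out) \<leadsto>\<^sup>* d"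
  by (rule converse_rtranclp_into_rtranclp[of exec_step, OF exec_step.eval[OF push]])

lemma run_Lam: "(subst 0 u t \<star> \<pi>, \<iota>, out) \<leadsto>\<^sup>* d \<Longrightarrow> (Lam t \<star> u # \<pi>, \<iota>, out) \<leadsto>\<^sup>* d"
  by (rule converse_rtranclp_into_rtranclp[of exec_step, OF exec_step.eval[OF grab]])

lemma run_Rd_False:
  "(t \<star> \<pi>, \<iota>, out) \<leadsto>\<^sup>* d \<Longrightarrow> (Rd \<star> t # u # v # \<pi>, False # \<iota>, out) \<leadsto>\<^sup>* d"
  by (rule converse_rtranclp_into_rtranclp[of exec_step, OF read0])

lemma run_Rd_True:
  "(u \<star> \<pi>, \<iota>, out) \<leadsto>\<^sup>* d \<Longrightarrow> (Rd \<star> t # u # v # \<pi>, True # \<iota>, out) \<leadsto>\<^sup>* d"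
  by (rule converse_rtranclp_into_rtranclp[of exec_step, OF read1])

lemma run_Rd_Nil: "(v \<star> \<pi>, [], out) \<leadsto>\<^sup>* d \<Longrightarrow> (Rd \<star> t # u # v # \<pi>, [], out) \<leadsto>\<^sup>* d"
  by (rule converse_rtranclp_into_rtranclp[of exec_step, OF read_empty])

lemma run_W0: "(t \<star> \<pi>, \<iota>, False # out) \<leadsto>\<^sup>* d \<Longrightarrow> (W0 \<star> t # \<pi>, \<iota>, out) \<leadsto>\<^sup>* d"
  by (rule converse_rtranclp_into_rtranclp[of exec_step, OF write0])

lemma run_W1: "(t \<star> \<pi>, \<iota>, True # out) \<leadsto>\<^sup>* d \<Longrightarrow> (W1 \<star> t # \<pi>, \<iota>, out) \<leadsto>\<^sup>* d"
  by (rule converse_rtranclp_into_rtranclp[of exec_step, OF write1])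

lemma run_End: "(End \<star> \<pi>, \<iota>, out) \<leadsto>\<^sup>* (Top, \<iota>, out)"
  by (rule r_into_rtranclp[of exec_step, OF stop])

lemmas run_basic = run_App run_Lam run_Rd_False run_Rd_True run_Rd_Nil run_W0 run_W1 run_End


section \<open>Numerals, lists and fixed points\<close>

text \<open>
  The argument of \<open>suc_trm\<close> stands below its two binders, and those of \<open>pair_trm\<close> stand below its
  one: the indices of variables in them are raised by two and by one.
\<close>

definition suc_trm :: "trm \<Rightarrow> trm" where
  "suc_trm t = Lam (Lam (App (Var 0) t))"

definition pair_trm :: "trm \<Rightarrow> trm \<Rightarrow> trm" where
  "pair_trm t u = Lam (App (App (Var 0) t) u)"

primrec num :: "nat \<Rightarrow> trm" where
  "num 0 = Lam (Lam (Var 1))"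
| "num (Suc n) = suc_trm (num n)"

text \<open>
  The empty list may be any closed term, because programs know the arity of the functions they
  implement and never inspect it.
\<close>

primrec list_trm :: "nat list \<Rightarrow> trm" where
  "list_trm [] = End"
| "list_trm (x # xs) = pair_trm (num x) (list_trm xs)"

lemma is_term_suc_trm [simp]: "is_term k (suc_trm t) \<longleftrightarrow> is_term (Suc (Suc k)) t"
  by (simp add: suc_trm_def)

lemma subst_suc_trm [simp]: "subst k u (suc_trm t) = suc_trm (subst (Suc (Suc k)) u t)"
  by (simp add: suc_trm_def)

lemma is_term_pair_trm [simp]:
  "is_term k (pair_trm t u) \<longleftrightarrow> is_term (Suc k) t \<and> is_term (Suc k) u"
  by (simp add: pair_trm_def)

lemma subst_pair_trm [simp]:
  "subst k v (pair_trm t u) = pair_trm (subst (Suc k) v t) (subst (Suc k) v u)"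
  by (simp add: pair_trm_def)

lemma closed_num [simp]: "closed_term (num n)"
  by (induction n) auto

lemma closed_list_trm [simp]: "closed_term (list_trm xs)"
  by (induction xs) auto

text \<open>
  From here on codes of data are built, never unfolded: when a program substitutes codes into a
  constructor, the result is folded into the code of the larger datum.
\<close>

declare num.simps [simp del] list_trm.simps [simp del]

lemmas fold_codes [simp] = num.simps(2)[symmetric] list_trm.simps(2)[symmetric]

lemma run_num_0:
  assumes "closed_term z" "(z \<star> \<pi>, \<iota>, out) \<leadsto>\<^sup>* d"
  shows "(num 0 \<star> z # s # \<pi>, \<iota>, out) \<leadsto>\<^sup>* d"
  unfolding num.simps
  by (rule run_basic; simp?)+ (use assms in simp_all)

lemma run_num_Suc:
  assumes "(s \<star> num n # \<pi>, \<iota>, out) \<leadsto>\<^sup>* d"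
  shows "(num (Suc n) \<star> z # s # \<pi>, \<iota>, out) \<leadsto>\<^sup>* d"
  unfolding num.simps suc_trm_def
  by (rule run_basic; simp?)+ (use assms in simp)

lemma run_list_Cons:
  assumes "(c \<star> num x # list_trm xs # \<pi>, \<iota>, out) \<leadsto>\<^sup>* d"
  shows "(list_trm (x # xs) \<star> c # \<pi>, \<iota>, out) \<leadsto>\<^sup>* d"
  unfolding list_trm.simps pair_trm_def
  by (rule run_basic; simp?)+ (use assms in simp)

text \<open>
  \<open>fix_trm t\<close> is Turing's combinator \<open>(\<lambda>a f. f (a a f)) (\<lambda>a f. f (a a f))\<close> applied to \<open>t\<close>. Its head
  reduction supplies \<open>t\<close> with exactly the term \<open>fix_trm t\<close>, so a loop finds itself, unchanged, as
  its first argument.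
\<close>

definition fix_trm :: "trm \<Rightarrow> trm" where
  "fix_trm t =
     (let A = Lam (Lam (App (Var 0) (App (App (Var 1) (Var 1)) (Var 0)))) in App (App A A) t)"

lemma is_term_fix_trm [simp]: "is_term k (fix_trm t) \<longleftrightarrow> is_term k t"
  by (simp add: fix_trm_def Let_def)

text \<open>Naming the loop by \<open>l\<close> keeps it folded while its body is executed.\<close>

lemma run_fix:
  assumes "l = fix_trm t" "(t \<star> l # \<pi>, \<iota>, out) \<leadsto>\<^sup>* d"
  shows "(l \<star> \<pi>, \<iota>, out) \<leadsto>\<^sup>* d"
  unfolding assms(1) fix_trm_def Let_def
  by (rule run_basic; simp?)+ (use assms in \<open>simp add: fix_trm_def Let_def\<close>)

lemmas run = run_num_0 run_num_Suc run_list_Cons run_basic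


section \<open>Implementing partial recursive functions\<close>

text \<open>
  The continuation has to be closed because it is substituted below binders, and substitution does
  not lift. A comment next to each program shows it with named variables.
\<close>

definition implements :: "trm \<Rightarrow> nat \<Rightarrow> (nat list \<rightharpoonup> nat) \<Rightarrow> bool" where
  "implements F k g \<longleftrightarrow> closed_term F \<and>
     (\<forall>xs y c \<pi> \<iota> out d. length xs = k \<longrightarrow> g xs = Some y \<longrightarrow> closed_term c \<longrightarrow>
        (c \<star> num y # \<pi>, \<iota>, out) \<leadsto>\<^sup>* d \<longrightarrow> (F \<star> list_trm xs # c # \<pi>, \<iota>, out) \<leadsto>\<^sup>* d)"

lemma implementsI:
  assumes "closed_term F"
    and "\<And>xs y c \<pi> \<iota> out d. length xs = k \<Longrightarrow> g xs = Some y \<Longrightarrow> closed_term c \<Longrightarrow>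
      (c \<star> num y # \<pi>, \<iota>, out) \<leadsto>\<^sup>* d \<Longrightarrow> (F \<star> list_trm xs # c # \<pi>, \<iota>, out) \<leadsto>\<^sup>* d"
  shows "implements F k g"
  using assms unfolding implements_def by blast

lemma implements_closed: "implements F k g \<Longrightarrow> closed_term F"
  by (simp add: implements_def)

lemma implements_run:
  "implements F k g \<Longrightarrow> length xs = k \<Longrightarrow> g xs = Some y \<Longrightarrow> closed_term c \<Longrightarrow>
    (c \<star> num y # \<pi>, \<iota>, out) \<leadsto>\<^sup>* d \<Longrightarrow> (F \<star> list_trm xs # c # \<pi>, \<iota>, out) \<leadsto>\<^sup>* d"
  unfolding implements_def by blast

lemma implements_zero: "\<exists>F. implements F k (\<lambda>xs. Some 0)"
proof
  \<comment> \<open>\<open>\<lambda>l c. c 0\<close>\<close>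
  show "implements (Lam (Lam (App (Var 0) (num 0)))) k (\<lambda>xs. Some 0)"
    by (rule implementsI, simp) (rule run; simp?)+
qed

lemma implements_succ: "\<exists>F. implements F 1 (\<lambda>xs. Some (Suc (hd xs)))"
proof
  \<comment> \<open>\<open>\<lambda>l c. l (\<lambda>x xs. c (suc x))\<close>\<close>
  show "implements (Lam (Lam (App (Var 1) (Lam (Lam (App (Var 2) (suc_trm (Var 3))))))))
    1 (\<lambda>xs. Some (Suc (hd xs)))"
  proof (rule implementsI, goal_cases)
    case (2 xs y c \<pi> \<iota> out d)
    then obtain x where "xs = [x]" "y = Suc x"
      by (cases xs) auto
    with 2 show ?case
      by - (simp, (rule run; simp?)+)
  qed simp
qed

lemma implements_proj: "i < k \<Longrightarrow> \<exists>F. implements F k (\<lambda>xs. Some (xs ! i))"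
proof (induction i arbitrary: k)
  case 0
  \<comment> \<open>\<open>\<lambda>l c. l (\<lambda>x xs. c x)\<close>\<close>
  have "implements (Lam (Lam (App (Var 1) (Lam (Lam (App (Var 2) (Var 1)))))))
    k (\<lambda>xs. Some (xs ! 0))"
  proof (rule implementsI, goal_cases)
    case (2 xs y c \<pi> \<iota> out d)
    with 0 obtain x xs' where "xs = x # xs'" "y = x"
      by (cases xs) auto
    with 2 show ?case
      by - (simp, (rule run; simp?)+)
  qed simp
  then show ?case ..
next
  case (Suc i)
  then have "i < k - 1"
    by simp
  then obtain F where F: "implements F (k - 1) (\<lambda>xs. Some (xs ! i))"
    using Suc.IH by blast
  note [simp] = implements_closed[OF F]
  \<comment> \<open>\<open>\<lambda>l c. l (\<lambda>x xs. F xs c)\<close>\<close>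
  have "implements (Lam (Lam (App (Var 1) (Lam (Lam (App (App F (Var 0)) (Var 2)))))))
    k (\<lambda>xs. Some (xs ! Suc i))"
  proof (rule implementsI, goal_cases)
    case (2 xs y c \<pi> \<iota> out d)
    with Suc.prems obtain x xs' where "xs = x # xs'" "y = xs' ! i" "length xs' = k - 1"
      by (cases xs) auto
    with 2 show ?case
      by - (simp, (rule run implements_run[OF F]; simp?)+)
  qed simp
  then show ?case ..
qed

text \<open>
  Composition first evaluates all inner functions and collects their values in a list, on which the
  outer function is then called. Here \<open>H\<close> is the part that builds the list.
\<close>

lemma implements_inner_functions:
  assumes "\<forall>g\<in>set gs. \<exists>F. implements F k g"
  shows "\<exists>H. closed_term H \<and>
    (\<forall>xs ys c \<pi> \<iota> out d. length xs = k \<longrightarrow> those (map (\<lambda>g. g xs) gs) = Some ys \<longrightarrow>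
      closed_term c \<longrightarrow> (c \<star> list_trm ys # \<pi>, \<iota>, out) \<leadsto>\<^sup>* d \<longrightarrow>
      (H \<star> list_trm xs # c # \<pi>, \<iota>, out) \<leadsto>\<^sup>* d)"
  using assms
proof (induction gs)
  case Nil
  \<comment> \<open>\<open>\<lambda>l c. c []\<close>\<close>
  show ?case
    by (rule exI[of _ "Lam (Lam (App (Var 0) (list_trm [])))"], intro conjI allI impI, simp)
      (rule run; simp)+
next
  case (Cons g gs)
  then obtain H where [simp]: "closed_term H"
    and H: "\<And>xs ys c \<pi> \<iota> out d. length xs = k \<Longrightarrow> those (map (\<lambda>g. g xs) gs) = Some ys \<Longrightarrow>
      closed_term c \<Longrightarrow> (c \<star> list_trm ys # \<pi>, \<iota>, out) \<leadsto>\<^sup>* d \<Longrightarrow>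
      (H \<star> list_trm xs # c # \<pi>, \<iota>, out) \<leadsto>\<^sup>* d"
    by auto
  from Cons.prems obtain G where G: "implements G k g"
    by auto
  note [simp] = implements_closed[OF G]
  \<comment> \<open>\<open>\<lambda>l c. G l (\<lambda>y. H l (\<lambda>ys. c (y # ys)))\<close>\<close>
  define K where "K = Lam (Lam (App (App G (Var 1))
    (Lam (App (App H (Var 2)) (Lam (App (Var 2) (pair_trm (Var 2) (Var 1))))))))"
  show ?case
  proof (intro exI[of _ K] conjI allI impI, goal_cases)
    case 1
    show ?case by (simp add: K_def)
  next
    case (2 xs ys c \<pi> \<iota> out d)
    then obtain z zs where "g xs = Some z" "those (map (\<lambda>g. g xs) gs) = Some zs" "ys = z # zs"
      by (auto split: option.splits)
    with 2 show ?case
      unfolding K_def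
      by - (rule run implements_run[OF G] H; simp?)+
  qed
qed

lemma implements_compose:
  assumes "\<exists>F. implements F (length gs) f" "\<forall>g\<in>set gs. \<exists>F. implements F k g"
  shows "\<exists>F. implements F k (compose f gs)"
proof -
  obtain F where F: "implements F (length gs) f"
    using assms(1) ..
  note [simp] = implements_closed[OF F]
  obtain H where [simp]: "closed_term H"
    and H: "\<And>xs ys c \<pi> \<iota> out d. length xs = k \<Longrightarrow> those (map (\<lambda>g. g xs) gs) = Some ys \<Longrightarrow>
      closed_term c \<Longrightarrow> (c \<star> list_trm ys # \<pi>, \<iota>, out) \<leadsto>\<^sup>* d \<Longrightarrow>
      (H \<star> list_trm xs # c # \<pi>, \<iota>, out) \<leadsto>\<^sup>* d"
    using implements_inner_functions[OF assms(2)] by blast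
  have length_those: "those us = Some ys \<Longrightarrow> length ys = length us" for us and ys :: "nat list"
    by (induction us arbitrary: ys) (auto split: option.splits)
  \<comment> \<open>\<open>\<lambda>l c. H l (\<lambda>ys. F ys c)\<close>\<close>
  have "implements (Lam (Lam (App (App H (Var 1)) (Lam (App (App F (Var 0)) (Var 1))))))
    k (compose f gs)"
  proof (rule implementsI, goal_cases)
    case (2 xs y c \<pi> \<iota> out d)
    then obtain ys where "those (map (\<lambda>g. g xs) gs) = Some ys" "f ys = Some y"
      by (auto simp: compose_def bind_eq_Some_conv)
    moreover from this have "length ys = length gs"
      using length_those by fastforce
    ultimately show ?case
      using 2 by - (rule run implements_run[OF F] H; simp?)+
  qed simp
  then show ?thesis ..
qed

text \<open>
  \<open>fix (\<lambda>r n l c. n (F l c) (\<lambda>m. r m l (\<lambda>v. G (m # v # l) c)))\<close>: the pending applications of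
  \<open>G\<close> accumulate in the continuation while the argument is counted down.
\<close>

definition prim_rec_loop :: "trm \<Rightarrow> trm \<Rightarrow> trm" where
  "prim_rec_loop F G = fix_trm (Lam (Lam (Lam (Lam
     (App (App (Var 2) (App (App F (Var 1)) (Var 0)))
       (Lam (App (App (App (Var 4) (Var 0)) (Var 2))
         (Lam (App (App G (pair_trm (Var 2) (pair_trm (Var 2) (Var 5)))) (Var 2))))))))))"

lemma implements_prim_recursion:
  assumes "\<exists>F. implements F k f" "\<exists>G. implements G (k + 2) g"
  shows "\<exists>F. implements F (k + 1) (prim_recursion f g)"
proof -
  obtain F G where F: "implements F k f" and G: "implements G (k + 2) g"
    using assms by blast
  note [simp] = implements_closed[OF F] implements_closed[OF G]
  have [simp]: "closed_term (prim_rec_loop F G)"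
    by (simp add: prim_rec_loop_def)
  note run_loop = run_fix[OF prim_rec_loop_def]
  have loop: "(prim_rec_loop F G \<star> num n # list_trm xs # c # \<pi>, \<iota>, out) \<leadsto>\<^sup>* d"
    if "length xs = k" "prim_recursion f g (n # xs) = Some y" "closed_term c"
      "(c \<star> num y # \<pi>, \<iota>, out) \<leadsto>\<^sup>* d" for n xs y c \<pi> \<iota> out d
    using that
  proof (induction n arbitrary: y c)
    case 0
    then show ?case
      by - (rule run run_loop implements_run[OF F]; simp?)+
  next
    case (Suc n)
    from Suc.prems obtain v where
      "prim_recursion f g (n # xs) = Some v" "g (n # v # xs) = Some y"
      by (auto simp: bind_eq_Some_conv)
    with Suc.prems show ?case
      by - (rule Suc.IH run_loop run implements_run[OF G]; simp?)+
  qed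
  \<comment> \<open>\<open>\<lambda>l c. l (\<lambda>n xs. loop n xs c)\<close>\<close>
  have "implements (Lam (Lam (App (Var 1)
    (Lam (Lam (App (App (App (prim_rec_loop F G) (Var 1)) (Var 0)) (Var 2)))))))
    (k + 1) (prim_recursion f g)"
  proof (rule implementsI, goal_cases)
    case (2 xs y c \<pi> \<iota> out d)
    then obtain n xs' where "xs = n # xs'" "length xs' = k"
      by (cases xs) auto
    with 2 show ?case
      by - (simp, (rule run loop; simp?)+)
  qed simp
  then show ?thesis ..
qed

text \<open>
  \<open>fix (\<lambda>r n l c. F (n # l) (\<lambda>y. y (c n) (\<lambda>m. r (suc n) l c)))\<close>: the value \<open>y\<close> is a numeral, so
  it decides itself between stopping with \<open>n\<close> and trying the next candidate.
\<close>

definition search_loop :: "trm \<Rightarrow> trm" where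
  "search_loop F = fix_trm (Lam (Lam (Lam (Lam
     (App (App F (pair_trm (Var 3) (Var 2)))
       (Lam (App (App (Var 0) (App (Var 1) (Var 3)))
         (Lam (App (App (App (Var 5) (suc_trm (Var 6))) (Var 3)) (Var 2))))))))))"

text \<open>
  All values below the result are defined, although the definition of minimization demands this only
  below some zero: that zero lies at or above the least one.
\<close>

lemma minimization_SomeD:
  assumes "minimization f xs = Some y"
  shows "f (y # xs) = Some 0" "m < y \<Longrightarrow> \<exists>v. f (m # xs) = Some (Suc v)"
proof -
  define P where "P = (\<lambda>n. f (n # xs) = Some 0)"
  obtain n where n: "P n" "\<forall>m<n. f (m # xs) \<noteq> None" and y: "y = (LEAST n. P n)"
    using assms by (auto simp: minimization_def P_def split: if_splits)
  show "f (y # xs) = Some 0"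
    using LeastI[of P, OF n(1)] by (simp add: y P_def)
  assume "m < y"
  then have "\<not> P m" "m < n"
    using not_less_Least[of m P] Least_le[of P n, OF n(1)] by (auto simp: y)
  then show "\<exists>v. f (m # xs) = Some (Suc v)"
    using n(2) by (cases "f (m # xs)") (auto simp: P_def gr0_conv_Suc)
qed

lemma implements_minimization:
  assumes "\<exists>F. implements F (k + 1) f"
  shows "\<exists>F. implements F k (minimization f)"
proof -
  obtain F where F: "implements F (k + 1) f"
    using assms ..
  note [simp] = implements_closed[OF F]
  have [simp]: "closed_term (search_loop F)"
    by (simp add: search_loop_def)
  note run_loop = run_fix[OF search_loop_def]
  have loop: "(search_loop F \<star> num n # list_trm xs # c # \<pi>, \<iota>, out) \<leadsto>\<^sup>* d"
    if "n \<le> y" "length xs = k" "minimization f xs = Some y" "closed_term c"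
      "(c \<star> num y # \<pi>, \<iota>, out) \<leadsto>\<^sup>* d" for n xs y c \<pi> \<iota> out d
    using that
  proof (induction n rule: inc_induct)
    case base
    with minimization_SomeD(1)[of f xs y] show ?case
      by - (rule run_loop run implements_run[OF F]; simp?)+
  next
    case (step n)
    then obtain v where "f (n # xs) = Some (Suc v)"
      using minimization_SomeD(2)[of f xs y n] by auto
    with step show ?case
      by - (rule run_loop run step.IH implements_run[OF F]; simp?)+
  qed
  \<comment> \<open>\<open>\<lambda>l c. loop 0 l c\<close>\<close>
  have "implements (Lam (Lam (App (App (App (search_loop F) (num 0)) (Var 1)) (Var 0))))
    k (minimization f)"
  proof (rule implementsI, goal_cases)
    case (2 xs y c \<pi> \<iota> out d)
    then show ?case
      by - (rule run loop[of 0 y]; simp?)+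
  qed simp
  then show ?thesis ..
qed

lemma implements_partial_recursive: "partial_recursive k g \<Longrightarrow> \<exists>F. implements F k g"
proof (induction rule: partial_recursive.induct)
  case (comp gs f k)
  then show ?case by (auto intro: implements_compose)
qed (auto intro: implements_zero implements_succ[simplified] implements_proj
    implements_prim_recursion[simplified] implements_minimization[simplified])


section \<open>Reading and printing numbers\<close>

text \<open>\<open>fix (\<lambda>r n c. n (c 0) (\<lambda>m. r m (\<lambda>d. c (suc (suc d)))))\<close>\<close>

definition double_trm :: trm where
  "double_trm = fix_trm (Lam (Lam (Lam
     (App (App (Var 1) (App (Var 0) (num 0)))
       (Lam (App (App (Var 3) (Var 0)) (Lam (App (Var 2) (suc_trm (suc_trm (Var 4)))))))))))"

lemma closed_double_trm [simp]: "closed_term double_trm"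
  by (simp add: double_trm_def)

lemma run_double:
  assumes "closed_term c" "(c \<star> num (2 * n) # \<pi>, \<iota>, out) \<leadsto>\<^sup>* d"
  shows "(double_trm \<star> num n # c # \<pi>, \<iota>, out) \<leadsto>\<^sup>* d"
  using assms
proof (induction n arbitrary: c)
  case 0
  then show ?case
    by - (rule run_fix[OF double_trm_def] run; simp?)+
next
  case (Suc n)
  then show ?case
    by - (rule Suc.IH run_fix[OF double_trm_def] run; simp?)+
qed

text \<open>
  \<open>fix (\<lambda>r n c0 c1. n (c0 0) (\<lambda>m. r m c1 (\<lambda>q. c0 (suc q))))\<close>: the parity of the number selects which
  continuation receives its half. Passing to the predecessor exchanges the two, and the half grows
  on the way back only if the number is even.
\<close>

definition half_trm :: trm where
  "half_trm = fix_trm (Lam (Lam (Lam (Lam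
     (App (App (Var 2) (App (Var 1) (num 0)))
       (Lam (App (App (App (Var 4) (Var 0)) (Var 1))
         (Lam (App (Var 3) (suc_trm (Var 2)))))))))))"

lemma closed_half_trm [simp]: "closed_term half_trm"
  by (simp add: half_trm_def)

lemma run_half:
  assumes "closed_term c0" "closed_term c1"
    and "((if odd n then c1 else c0) \<star> num (n div 2) # \<pi>, \<iota>, out) \<leadsto>\<^sup>* d"
  shows "(half_trm \<star> num n # c0 # c1 # \<pi>, \<iota>, out) \<leadsto>\<^sup>* d"
  using assms
proof (induction n arbitrary: c0 c1)
  case 0
  then show ?case
    by - (rule run_fix[OF half_trm_def] run; simp?)+
next
  case (Suc n)
  have "((if odd n then Lam (App c0 (suc_trm (Var 2))) else c1) \<star> num (n div 2) # \<pi>, \<iota>, out)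
    \<leadsto>\<^sup>* d"
  proof (cases "odd n")
    case True
    with Suc.prems show ?thesis
      by - (simp, (rule run; simp?)+)
  qed (use Suc.prems in auto)
  with Suc.prems(1,2) show ?case
    by - (rule Suc.IH run_fix[OF half_trm_def] run; simp?)+
qed

text \<open>\<open>fix (\<lambda>r y. y end (\<lambda>m. half y (\<lambda>q. w0 (r q)) (\<lambda>q. w1 (r q))))\<close>\<close>

definition print_trm :: trm where
  "print_trm = fix_trm (Lam (Lam (App (App (Var 0) End)
     (Lam (App (App (App half_trm (Var 1))
       (Lam (App W0 (App (Var 3) (Var 0)))))
       (Lam (App W1 (App (Var 3) (Var 0)))))))))"

lemma closed_print_trm [simp]: "closed_term print_trm"
  by (simp add: print_trm_def)

lemma prints_number: "(print_trm \<star> num y # \<pi>, \<iota>, out) \<leadsto>\<^sup>* (Top, \<iota>, bin y @ out)"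
proof (induction y arbitrary: \<pi> out rule: less_induct)
  case (less y)
  show ?case
  proof (cases y)
    case 0
    then show ?thesis
      by - (simp add: bin.simps[of 0], (rule run_fix[OF print_trm_def] run; simp?)+)
  next
    case (Suc m)
    then have "bin y = bin (y div 2) @ [odd y]" "y div 2 < y"
      by (simp_all add: bin.simps[of "Suc m"])
    then have IH: "(print_trm \<star> num (y div 2) # \<pi>, \<iota>, odd y # out) \<leadsto>\<^sup>* (Top, \<iota>, bin y @ out)"
      using less.IH[of "y div 2" \<pi> "odd y # out"] by simp
    let ?c0 = "Lam (App W0 (App print_trm (Var 0)))" and ?c1 = "Lam (App W1 (App print_trm (Var 0)))"
    have "((if odd y then ?c1 else ?c0) \<star> num (y div 2) # \<pi>, \<iota>, out)
      \<leadsto>\<^sup>* (Top, \<iota>, bin y @ out)"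
      using IH by - (cases "odd y"; simp; (rule run; simp?)+)
    then have half: "(half_trm \<star> num y # ?c0 # ?c1 # \<pi>, \<iota>, out) \<leadsto>\<^sup>* (Top, \<iota>, bin y @ out)"
      by (intro run_half) simp_all
    with Suc show ?thesis
      by - (simp, (rule run_fix[OF print_trm_def] run; simp?)+)
  qed
qed

text \<open>
  \<open>fix (\<lambda>r a. read (double a r) (double a (\<lambda>d. r (suc d))) (c a))\<close>: the loop itself is the
  continuation that receives the new accumulator.
\<close>

definition read_trm :: "trm \<Rightarrow> trm" where
  "read_trm c = fix_trm (Lam (Lam (App (App (App Rd
     (App (App double_trm (Var 0)) (Var 1)))
     (App (App double_trm (Var 0)) (Lam (App (Var 2) (suc_trm (Var 2))))))
     (App c (Var 0)))))"

lemma closed_read_trm [simp]: "closed_term c \<Longrightarrow> closed_term (read_trm c)"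
  by (simp add: read_trm_def)

lemma run_read_digits:
  assumes "closed_term c"
    and "(c \<star> num (foldl (\<lambda>a b. 2 * a + of_bool b) a bs) # \<pi>, [], out) \<leadsto>\<^sup>* d"
  shows "(read_trm c \<star> num a # \<pi>, bs, out) \<leadsto>\<^sup>* d"
  using assms
proof (induction bs arbitrary: a)
  case Nil
  then show ?case
    by - (rule run_fix[OF read_trm_def] run; simp?)+
next
  case (Cons b bs)
  have IH: "(read_trm c \<star> num (2 * a + of_bool b) # \<pi>, bs, out) \<leadsto>\<^sup>* d"
    using Cons by simp
  with Cons.prems(1) show ?case
    by - (cases b; simp; (rule run_fix[OF read_trm_def] run_double run; simp?)+)
qed

lemma foldl_bin: "foldl (\<lambda>a b. 2 * a + of_bool b) 0 (bin n) = n"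
  by (induction n rule: bin.induct) (subst bin.simps, auto)

lemma reads_number:
  assumes "closed_term c" "(c \<star> num n # \<pi>, [], out) \<leadsto>\<^sup>* d"
  shows "(read_trm c \<star> num 0 # \<pi>, bin n, out) \<leadsto>\<^sup>* d"
  using assms by (intro run_read_digits) (simp_all add: foldl_bin)


section \<open>Computable functions are implemented by processes\<close>

theorem theorem12:
  fixes f :: "nat \<rightharpoonup> nat"
  assumes "computable f"
  shows "\<exists>p. is_process p \<and>
    (\<forall>n\<in>dom f. (p, bin n, []) \<leadsto>\<^sup>* (Top, [], bin (the (f n))))"
proof -
  obtain g F where g: "\<And>n. f n = g [n]" and F: "implements F 1 g"
    using assms implements_partial_recursive by (fastforce simp: computable_def)
  note [simp] = implements_closed[OF F]
  \<comment> \<open>\<open>\<lambda>a. F [a] print\<close>\<close>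
  define c where "c = Lam (App (App F (pair_trm (Var 1) (list_trm []))) print_trm)"
  have c: "closed_term c"
    by (simp add: c_def)
  have "(read_trm c \<star> [num 0], bin n, []) \<leadsto>\<^sup>* (Top, [], bin y)" if "f n = Some y" for n y
  proof (rule reads_number[OF c])
    show "(c \<star> [num n], [], []) \<leadsto>\<^sup>* (Top, [], bin y)"
      unfolding c_def using that g prints_number[of y "[]" "[]" "[]"]
      by - (rule run implements_run[OF F]; simp?)+
  qed
  then show ?thesis
    using c by (intro exI[of _ "read_trm c \<star> [num 0]"]) (auto simp: is_stack_def)
qed

end
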